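(* Let $(U,\gamma)$ be a parallelism structure on $U$, with Cartan curvature field $\mathbf{\Omega}$ and Cartan connection operators of first and second kind $\gamma^{+}$ and $\gamma^{-}$. For any $c,d\in\mathcal{V}(U)$, $$\mathbf{\Omega}(c,d)=\partial_o\wedge\gamma^{+}(c,d)+\gamma^{+}(c,\partial_s)\wedge\gamma^{-}(s,d),$$ where $\gamma^{+}(c,\partial_s)\wedge\gamma^{-}(s,d)=\sum_\mu\gamma^{+}(c,b_\mu)\wedge\gamma^{-}(b_\mu,d)$.
   Context: $M$ is an $n$-dimensional smooth manifold, $(U_o,\phi_o)$ a chart with coordinates $x^1,\dots,x^n$, and $U\subset U_o$ open. The canonical space $\mathcal{U}_o$ is an $n$-dimensional real vector space with basis $b_1,\dots,b_n$ and the Euclidean scalar product $b_\mu\cdot b_\nu=\delta_{\mu\nu}$. $\mathcal{S}(U),\mathcal{V}(U),\mathcal{M}(U)$ denote smooth maps from $U$ to $\mathbb{R},\mathcal{U}_o,\bigwedge\mathcal{U}_o$. For $a\in\mathcal{U}_o$ (or pointwise for $a\in\mathcal V(U)$), $a\cdot\partial_o X=\sum_\mu(a\cdot b_\mu)\,\partial X/\partial x^\mu$ (componentwise), and $\partial_o\wedge X=\sum_\mu b_\mu\wedge\partial X/\partial x^\mu$. The Lie bracket is $[a,b]=a\cdot\partial_ob-b\cdot\partial_oa$. A parallelism structure $(U,\gamma)$ consists of $U$ and a connection field $\gamma$: a smooth map on $U$ with values bilinear maps $\mathcal{U}_o\times\mathcal{U}_o\to\mathcal{U}_o$; $\gamma_a(b)=\gamma(a,b)$,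 and ${}^\dagger$ is the Euclidean adjoint. On vector fields $b$: $\nabla_a^{+}b=a\cdot\partial_ob+\gamma_a(b)$ and $\nabla_a^{-}b=a\cdot\partial_ob-\gamma_a^{\dagger}(b)$. Curvature field: $\rho(a,b,c)=[\nabla_a^{+},\nabla_b^{+}]c-\nabla_{[a,b]}^{+}c$ for $a,b,c\in\mathcal{V}(U)$ (it is tensorial in all arguments). The symbol $\partial_a$ denotes differentiation with respect to a vector variable $a$; applied to an expression $F(a)$ linear in $a$ it means $\partial_a\ast F(a)=\sum_\mu b_\mu\ast F(b_\mu)$. Cartan curvature field: $\mathbf{\Omega}(c,d)=\frac12\,\partial_a\wedge\partial_b\,(\rho(a,b,c)\cdot d)=\frac12\sum_{\mu,\nu}(\rho(b_\mu,b_\nu,c)\cdot d)\,b_\mu\wedge b_\nu$. Cartan connection operators, for $b,c\in\mathcal V(U)$: of first kind $\gamma^{+}(b,c)=\partial_a\,((\nabla_a^{+}b)\cdot c)=\sum_\mu((\nabla_{b_\mu}^{+}b)\cdot c)\,b_\mu$; of second kind $\gamma^{-}(b,c)=\partial_a\,(b\cdot(\nabla_a^{-}c))=\sum_\mu(b\cdot\nabla_{b_\mu}^{-}c)\,b_\mu$. *)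

theory Defs
  imports "HOL-Analysis.Analysis"
begin

section \<open>Smooth maps on open subsets of normed spaces\<close>

primrec Ck_on :: "nat \<Rightarrow> ('a::real_normed_vector \<Rightarrow> 'b::real_normed_vector) \<Rightarrow> 'a set \<Rightarrow> bool" where
  "Ck_on 0 f S \<longleftrightarrow> continuous_on S f"
| "Ck_on (Suc k) f S \<longleftrightarrow>
     (\<forall>x\<in>S. f differentiable (at x)) \<and> (\<forall>v. Ck_on k (\<lambda>x. frechet_derivative f (at x) v) S)"

definition smooth_on :: "('a::real_normed_vector \<Rightarrow> 'b::real_normed_vector) \<Rightarrow> 'a set \<Rightarrow> bool" where
  "smooth_on f S \<longleftrightarrow> (\<forall>k. Ck_on k f S)"


section \<open>Smooth manifolds modelled on \<open>real ^ 'n\<close>\<close>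

text \<open>\<open>real ^ 'n\<close>, with its standard basis and inner product, also serves as the canonical space.\<close>

type_synonym 'n canonical = "(real, 'n) vec"

text \<open>A chart is a pair of a domain and a coordinate map; the values of the coordinate map
  outside of the domain are irrelevant.\<close>

type_synonym ('m, 'n) chart = "'m set \<times> ('m \<Rightarrow> 'n canonical)"

definition chart_inv :: "('m, 'n::finite) chart \<Rightarrow> 'n canonical \<Rightarrow> 'm" where
  "chart_inv \<kappa> = inv_into (fst \<kappa>) (snd \<kappa>)"

definition is_chart :: "('m::topological_space, 'n::finite) chart \<Rightarrow> bool" where
  "is_chart \<kappa> \<longleftrightarrow> open (fst \<kappa>) \<and> open (snd \<kappa> ` fst \<kappa>) \<and>
     homeomorphism (fst \<kappa>) (snd \<kappa> ` fst \<kappa>) (snd \<kappa>) (chart_inv \<kappa>)"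

definition smooth_atlas ::
  "('m::{t2_space, second_countable_topology}, 'n::finite) chart set \<Rightarrow> bool" where
  "smooth_atlas \<A> \<longleftrightarrow> (\<forall>\<kappa>\<in>\<A>. is_chart \<kappa>) \<and> (\<Union>\<kappa>\<in>\<A>. fst \<kappa>) = UNIV \<and>
     (\<forall>\<kappa>\<in>\<A>. \<forall>\<kappa>'\<in>\<A>. smooth_on (snd \<kappa>' \<circ> chart_inv \<kappa>) (snd \<kappa> ` (fst \<kappa> \<inter> fst \<kappa>')))"

definition smooth_map ::
  "('m, 'n::finite) chart set \<Rightarrow> 'm set \<Rightarrow> ('m \<Rightarrow> 'v::real_normed_vector) \<Rightarrow> bool" where
  "smooth_map \<A> U X \<longleftrightarrow>
     (\<forall>\<kappa>\<in>\<A>. smooth_on (X \<circ> chart_inv \<kappa>) (snd \<kappa> ` (fst \<kappa> \<inter> U)))"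


section \<open>The canonical space and its exterior algebra\<close>

abbreviation (input) bvec :: "'n::finite \<Rightarrow> 'n canonical" where
  "bvec \<mu> \<equiv> axis \<mu> 1"

text \<open>A multivector is given by its coefficients with respect to the basis of blades
  \<open>e\<^sub>I = b\<^bsub>i\<^sub>1\<^esub> \<and> \<dots> \<and> b\<^bsub>i\<^sub>k\<^esub>\<close>, where \<open>I = {i\<^sub>1 < \<dots> < i\<^sub>k}\<close> ranges over all sets of indices.
  For disjoint \<open>I\<close> and \<open>J\<close> one has \<open>e\<^sub>I \<and> e\<^sub>J = blade_sign I J e\<^bsub>I \<union> J\<^esub>\<close>, and
  \<open>e\<^sub>I \<and> e\<^sub>J = 0\<close> otherwise.\<close>

type_synonym 'n multivector = "(real, 'n set) vec"

definition blade_sign :: "'n::{finite, linorder} set \<Rightarrow> 'n set \<Rightarrow> real" where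
  "blade_sign I J = (-1) ^ card {(i, j). i \<in> I \<and> j \<in> J \<and> j < i}"

definition wedge ::
  "'n::{finite, linorder} multivector \<Rightarrow> 'n multivector \<Rightarrow> 'n multivector"
  (infixl \<open>\<curlywedge>\<close> 70) where
  "X \<curlywedge> Y = (\<chi> K. \<Sum>I\<in>Pow K. blade_sign I (K - I) * (X $ I) * (Y $ (K - I)))"

text \<open>The inclusion of the canonical space into its exterior algebra.\<close>

definition mv :: "'n canonical \<Rightarrow> 'n::{finite, linorder} multivector" where
  "mv a = (\<Sum>i\<in>UNIV. (a $ i) *\<^sub>R axis {i} 1)"

lemma bounded_bilinear_wedge: "bounded_bilinear (\<curlywedge>)"
proof -
  have "bilinear ((\<curlywedge>) :: 'n::{finite, linorder} multivector \<Rightarrow> _)"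
    unfolding bilinear_def
    by (intro conjI allI linearI)
      (simp_all add: wedge_def vec_eq_iff algebra_simps sum.distrib sum_distrib_left)
  then show ?thesis
    by (simp add: bilinear_conv_bounded_bilinear)
qed

lemma linear_mv: "linear mv"
  by (rule linearI) (simp_all add: mv_def scaleR_sum_right algebra_simps sum.distrib)

lemma mv_bvec: "mv (bvec i) = axis {i} 1"
proof -
  have "mv (bvec i) = (\<Sum>j\<in>UNIV. if j = i then axis {i} 1 else 0)"
    unfolding mv_def by (rule sum.cong) (auto simp: axis_def)
  then show ?thesis by simp
qed

lemma wedge_blades:
  "axis I 1 \<curlywedge> axis J 1 = (if I \<inter> J = {} then blade_sign I J *\<^sub>R axis (I \<union> J) 1 else 0)"
proof (rule vec_eq_iff[THEN iffD2], rule allI)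
  fix K
  have "(axis I 1 \<curlywedge> axis J 1) $ K =
      (\<Sum>L\<in>Pow K. if L = I then (if K - I = J then blade_sign I J else 0) else 0)"
    unfolding wedge_def vec_lambda_beta by (rule sum.cong) (auto simp: axis_def)
  also have "\<dots> = (if I \<subseteq> K then (if K - I = J then blade_sign I J else 0) else 0)"
    by simp
  also have "\<dots> = (if I \<inter> J = {} then blade_sign I J *\<^sub>R axis (I \<union> J) 1 else 0) $ K"
    by (auto simp: axis_def)
  finally show "(axis I 1 \<curlywedge> axis J 1) $ K =
      (if I \<inter> J = {} then blade_sign I J *\<^sub>R axis (I \<union> J) 1 else 0) $ K" .
qed

lemma wedge_blade_Min:
  assumes "\<And>j. j \<in> I \<Longrightarrow> i < j"
  shows "mv (bvec i) \<curlywedge> axis I 1 = axis (insert i I) 1"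
proof -
  have "{(k, j). k \<in> {i} \<and> j \<in> I \<and> j < k} = {}" "{i} \<inter> I = {}"
    using assms by (auto dest: less_asym)
  then have "blade_sign {i} I = 1" "{i} \<inter> I = {}"
    unfolding blade_sign_def by (simp_all only: card.empty power_0)
  then show ?thesis
    by (simp add: mv_bvec wedge_blades)
qed

lemma blade_sign_Un_left:
  assumes "I \<inter> J = {}"
  shows "blade_sign (I \<union> J) K = blade_sign I K * blade_sign J K"
proof -
  have "{(i, j). i \<in> I \<union> J \<and> j \<in> K \<and> j < i} =
      {(i, j). i \<in> I \<and> j \<in> K \<and> j < i} \<union> {(i, j). i \<in> J \<and> j \<in> K \<and> j < i}" by auto
  moreover have "card \<dots> =
      card {(i, j). i \<in> I \<and> j \<in> K \<and> j < i} + card {(i, j). i \<in> J \<and> j \<in> K \<and> j < i}"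
    using assms by (intro card_Un_disjoint) auto
  ultimately show ?thesis by (simp add: blade_sign_def power_add)
qed

lemma blade_sign_Un_right:
  assumes "J \<inter> K = {}"
  shows "blade_sign I (J \<union> K) = blade_sign I J * blade_sign I K"
proof -
  have "{(i, j). i \<in> I \<and> j \<in> J \<union> K \<and> j < i} =
      {(i, j). i \<in> I \<and> j \<in> J \<and> j < i} \<union> {(i, j). i \<in> I \<and> j \<in> K \<and> j < i}" by auto
  moreover have "card \<dots> =
      card {(i, j). i \<in> I \<and> j \<in> J \<and> j < i} + card {(i, j). i \<in> I \<and> j \<in> K \<and> j < i}"
    using assms by (intro card_Un_disjoint) auto
  ultimately show ?thesis by (simp add: blade_sign_def power_add)
qed

lemma wedge_assoc: "(X \<curlywedge> Y) \<curlywedge> Z = X \<curlywedge> (Y \<curlywedge> Z)"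
proof (rule vec_eq_iff[THEN iffD2], rule allI)
  fix K
  let ?t = "\<lambda>I J. blade_sign I J * blade_sign I (K - I - J) * blade_sign J (K - I - J) *
    (X $ I) * (Y $ J) * (Z $ (K - I - J))"
  have "((X \<curlywedge> Y) \<curlywedge> Z) $ K =
      (\<Sum>L\<in>Pow K. \<Sum>I\<in>Pow L. ?t I (L - I))"
  proof -
    have "blade_sign L (K - L) * (\<Sum>I\<in>Pow L. blade_sign I (L - I) * X $ I * Y $ (L - I)) *
        Z $ (K - L) = (\<Sum>I\<in>Pow L. ?t I (L - I))" if "L \<in> Pow K" for L
    proof -
      have "blade_sign L (K - L) * (blade_sign I (L - I) * X $ I * Y $ (L - I)) * Z $ (K - L) =
          ?t I (L - I)" if "I \<in> Pow L" for I
      proof -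
        have "K - I - (L - I) = K - L" "I \<union> (L - I) = L" "I \<inter> (L - I) = {}"
          using that by auto
        then show ?thesis
          using blade_sign_Un_left[of I "L - I" "K - L"] by simp
      qed
      then show ?thesis
        unfolding sum_distrib_left sum_distrib_right by (intro sum.cong) auto
    qed
    then show ?thesis by (simp add: wedge_def)
  qed
  also have "\<dots> = (\<Sum>(L, I)\<in>Sigma (Pow K) Pow. ?t I (L - I))"
    by (rule sum.Sigma) auto
  also have "\<dots> = (\<Sum>(I, J)\<in>Sigma (Pow K) (\<lambda>I. Pow (K - I)). ?t I J)"
  proof (rule sum.reindex_bij_witness[where i = "\<lambda>(I, J). (I \<union> J, I)" and j = "\<lambda>(L, I). (I, L - I)"])
  qed auto
  also have "\<dots> = (\<Sum>I\<in>Pow K. \<Sum>J\<in>Pow (K - I). ?t I J)"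
    by (rule sum.Sigma[symmetric]) auto
  also have "\<dots> = (X \<curlywedge> (Y \<curlywedge> Z)) $ K"
  proof -
    have "(\<Sum>J\<in>Pow (K - I). ?t I J) = blade_sign I (K - I) * X $ I *
        (\<Sum>J\<in>Pow (K - I). blade_sign J (K - I - J) * Y $ J * Z $ (K - I - J))" for I
    proof -
      have "?t I J = blade_sign I (K - I) * X $ I *
          (blade_sign J (K - I - J) * Y $ J * Z $ (K - I - J))" if "J \<in> Pow (K - I)" for J
      proof -
        have "J \<union> (K - I - J) = K - I" "J \<inter> (K - I - J) = {}"
          using that by auto
        then show ?thesis
          using blade_sign_Un_right[of J "K - I - J" I] by simp
      qed
      then show ?thesis
        unfolding sum_distrib_left by (intro sum.cong) auto
    qed
    then show ?thesis by (simp add: wedge_def)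
  qed
  finally show "((X \<curlywedge> Y) \<curlywedge> Z) $ K = (X \<curlywedge> (Y \<curlywedge> Z)) $ K" .
qed

lemma wedge_bvec_anticommute: "mv (bvec i) \<curlywedge> mv (bvec j) = - (mv (bvec j) \<curlywedge> mv (bvec i))"
proof -
  have s: "blade_sign {i} {j} = (if j < i then -1 else 1)" for i j :: "'a::{finite, linorder}"
  proof -
    have "{(k, l). k \<in> {i} \<and> l \<in> {j} \<and> l < k} = (if j < i then {(i, j)} else {})" by auto
    then show ?thesis by (simp add: blade_sign_def)
  qed
  show ?thesis
    by (auto simp: mv_bvec wedge_blades s insert_commute)
qed


section \<open>Differentiation in a chart\<close>

definition pderiv_chart ::
  "('m, 'n::finite) chart \<Rightarrow> 'n \<Rightarrow> ('m \<Rightarrow> 'v::real_normed_vector) \<Rightarrow> 'm \<Rightarrow> 'v" where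
  "pderiv_chart \<kappa> \<mu> X p =
     vector_derivative (\<lambda>t. X (chart_inv \<kappa> (snd \<kappa> p + t *\<^sub>R bvec \<mu>))) (at 0)"

definition dir_deriv ::
  "('m, 'n::finite) chart \<Rightarrow> ('m \<Rightarrow> 'n canonical) \<Rightarrow> ('m \<Rightarrow> 'v::real_normed_vector) \<Rightarrow> 'm \<Rightarrow> 'v" where
  "dir_deriv \<kappa> a X p = (\<Sum>\<mu>\<in>UNIV. (a p \<bullet> bvec \<mu>) *\<^sub>R pderiv_chart \<kappa> \<mu> X p)"

definition ext_deriv ::
  "('m, 'n::{finite, linorder}) chart \<Rightarrow> ('m \<Rightarrow> 'n multivector) \<Rightarrow> 'm \<Rightarrow> 'n multivector" where
  "ext_deriv \<kappa> X p = (\<Sum>\<mu>\<in>UNIV. mv (bvec \<mu>) \<curlywedge> pderiv_chart \<kappa> \<mu> X p)"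

definition lie_bracket ::
  "('m, 'n::finite) chart \<Rightarrow> ('m \<Rightarrow> 'n canonical) \<Rightarrow> ('m \<Rightarrow> 'n canonical) \<Rightarrow> 'm \<Rightarrow> 'n canonical" where
  "lie_bracket \<kappa> a b p = dir_deriv \<kappa> a b p - dir_deriv \<kappa> b a p"


section \<open>Parallelism structures\<close>

text \<open>All linear maps on \<open>real ^ 'n\<close> are bounded, so that this is the space of all bilinear maps.\<close>

type_synonym 'n bilin = "'n canonical \<Rightarrow>\<^sub>L ('n canonical \<Rightarrow>\<^sub>L 'n canonical)"

definition parallelism_structure ::
  "('m::topological_space, 'n::finite) chart set \<Rightarrow> ('m, 'n) chart \<Rightarrow> 'm set \<Rightarrow> ('m \<Rightarrow> 'n bilin) \<Rightarrow> bool"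
  where
  "parallelism_structure \<A> \<kappa> U \<gamma> \<longleftrightarrow>
     \<kappa> \<in> \<A> \<and> open U \<and> U \<subseteq> fst \<kappa> \<and> smooth_map \<A> U \<gamma>"

definition nabla_plus ::
  "('m, 'n::finite) chart \<Rightarrow> ('m \<Rightarrow> 'n bilin) \<Rightarrow> ('m \<Rightarrow> 'n canonical) \<Rightarrow> ('m \<Rightarrow> 'n canonical) \<Rightarrow> 'm \<Rightarrow> 'n canonical"
  where
  "nabla_plus \<kappa> \<gamma> a b p =
     dir_deriv \<kappa> a b p + blinfun_apply (blinfun_apply (\<gamma> p) (a p)) (b p)"

definition nabla_minus ::
  "('m, 'n::finite) chart \<Rightarrow> ('m \<Rightarrow> 'n bilin) \<Rightarrow> ('m \<Rightarrow> 'n canonical) \<Rightarrow> ('m \<Rightarrow> 'n canonical) \<Rightarrow> 'm \<Rightarrow> 'n canonical"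
  where
  "nabla_minus \<kappa> \<gamma> a b p =
     dir_deriv \<kappa> a b p - adjoint (blinfun_apply (blinfun_apply (\<gamma> p) (a p))) (b p)"

definition curvature ::
  "('m, 'n::finite) chart \<Rightarrow> ('m \<Rightarrow> 'n bilin) \<Rightarrow>
     ('m \<Rightarrow> 'n canonical) \<Rightarrow> ('m \<Rightarrow> 'n canonical) \<Rightarrow> ('m \<Rightarrow> 'n canonical) \<Rightarrow> 'm \<Rightarrow> 'n canonical" where
  "curvature \<kappa> \<gamma> a b c p =
     nabla_plus \<kappa> \<gamma> a (nabla_plus \<kappa> \<gamma> b c) p - nabla_plus \<kappa> \<gamma> b (nabla_plus \<kappa> \<gamma> a c) p
     - nabla_plus \<kappa> \<gamma> (lie_bracket \<kappa> a b) c p"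

definition cartan_curvature ::
  "('m, 'n::{finite, linorder}) chart \<Rightarrow> ('m \<Rightarrow> 'n bilin) \<Rightarrow>
     ('m \<Rightarrow> 'n canonical) \<Rightarrow> ('m \<Rightarrow> 'n canonical) \<Rightarrow> 'm \<Rightarrow> 'n multivector" where
  "cartan_curvature \<kappa> \<gamma> c d p =
     (1/2) *\<^sub>R (\<Sum>\<mu>\<in>UNIV. \<Sum>\<nu>\<in>UNIV.
       (curvature \<kappa> \<gamma> (\<lambda>_. bvec \<mu>) (\<lambda>_. bvec \<nu>) c p \<bullet> d p) *\<^sub>R (mv (bvec \<mu>) \<curlywedge> mv (bvec \<nu>)))"

definition cartan_conn_plus ::
  "('m, 'n::finite) chart \<Rightarrow> ('m \<Rightarrow> 'n bilin) \<Rightarrow>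
     ('m \<Rightarrow> 'n canonical) \<Rightarrow> ('m \<Rightarrow> 'n canonical) \<Rightarrow> 'm \<Rightarrow> 'n canonical" where
  "cartan_conn_plus \<kappa> \<gamma> b c p =
     (\<Sum>\<mu>\<in>UNIV. (nabla_plus \<kappa> \<gamma> (\<lambda>_. bvec \<mu>) b p \<bullet> c p) *\<^sub>R bvec \<mu>)"

definition cartan_conn_minus ::
  "('m, 'n::finite) chart \<Rightarrow> ('m \<Rightarrow> 'n bilin) \<Rightarrow>
     ('m \<Rightarrow> 'n canonical) \<Rightarrow> ('m \<Rightarrow> 'n canonical) \<Rightarrow> 'm \<Rightarrow> 'n canonical" where
  "cartan_conn_minus \<kappa> \<gamma> b c p =
     (\<Sum>\<mu>\<in>UNIV. (b p \<bullet> nabla_minus \<kappa> \<gamma> (\<lambda>_. bvec \<mu>) c p) *\<^sub>R bvec \<mu>)"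

end

theory Submission
  imports Defs
begin

text \<open>Put \<open>N\<^sub>\<nu> = \<nabla>\<^sup>+\<^bsub>b\<^sub>\<nu>\<^esub> c\<close>. As constant fields commute, antisymmetry of the wedge product gives
  \<open>\<Omega>(c,d) = \<Sum>\<^bsub>\<mu>,\<nu>\<^esub> ((\<partial>\<^sub>\<mu> N\<^sub>\<nu> + \<gamma>\<^sub>\<mu> N\<^sub>\<nu>) \<bullet> d) b\<^sub>\<mu> \<and> b\<^sub>\<nu>\<close>. By the product rule, the exterior derivative of
  \<open>\<gamma>\<^sup>+(c,d) = \<Sum>\<^sub>\<nu> (N\<^sub>\<nu> \<bullet> d) b\<^sub>\<nu>\<close> contributes \<open>\<partial>\<^sub>\<mu> N\<^sub>\<nu> \<bullet> d + N\<^sub>\<nu> \<bullet> \<partial>\<^sub>\<mu> d\<close>. Contracting over \<open>s\<close> gives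
  \<open>N\<^sub>\<mu> \<bullet> (\<partial>\<^sub>\<nu> d - \<gamma>\<^sub>\<nu>\<^sup>\<dagger> d)\<close> for the second term, which after interchanging \<open>\<mu>\<close> and \<open>\<nu>\<close> cancels
  \<open>N\<^sub>\<nu> \<bullet> \<partial>\<^sub>\<mu> d\<close> and supplies \<open>\<gamma>\<^sub>\<mu> N\<^sub>\<nu> \<bullet> d\<close>. Second derivatives of \<open>c\<close> never have to be interchanged.\<close>

section \<open>Smooth functions and open sets in a chart\<close>

lemma smooth_on_imp_differentiable:
  assumes "smooth_on f S" "x \<in> S"
  shows "f differentiable (at x)"
proof -
  have "Ck_on (Suc 0) f S"
    using assms(1) unfolding smooth_on_def by blast
  with assms(2) show ?thesis by simp
qed

lemma smooth_on_frechet_derivative: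
  assumes "smooth_on f S"
  shows "smooth_on (\<lambda>x. frechet_derivative f (at x) v) S"
  unfolding smooth_on_def
proof
  fix k
  have "Ck_on (Suc k) f S"
    using assms unfolding smooth_on_def by blast
  then show "Ck_on k (\<lambda>x. frechet_derivative f (at x) v) S" by simp
qed

lemma chart_inv_chart:
  assumes "is_chart \<kappa>" "p \<in> fst \<kappa>"
  shows "chart_inv \<kappa> (snd \<kappa> p) = p"
  using assms by (auto simp: is_chart_def homeomorphism_def)

text \<open>A homeomorphism carries relatively open sets to relatively open sets, and the image of
  the whole chart domain is itself open. Hence an identity valid on the image of \<open>U\<close>
  holds near each of its points and may be differentiated there.\<close>

lemma open_chart_image:
  assumes "is_chart \<kappa>" "open U" "U \<subseteq> fst \<kappa>"
  shows "open (snd \<kappa> ` U)"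
proof -
  have "openin (top_of_set (snd \<kappa> ` fst \<kappa>)) (snd \<kappa> ` U)"
    using assms unfolding is_chart_def
    by (intro homeomorphism_imp_open_map) (auto simp: openin_open)
  with assms(1) show ?thesis
    unfolding is_chart_def using openin_open_trans by blast
qed

section \<open>Partial derivatives along coordinate lines\<close>

lemma pderiv_chart_has_vector_derivative:
  assumes "(X \<circ> chart_inv \<kappa>) differentiable (at (snd \<kappa> p))"
  shows "((\<lambda>t. X (chart_inv \<kappa> (snd \<kappa> p + t *\<^sub>R bvec \<mu>))) has_vector_derivative
    frechet_derivative (X \<circ> chart_inv \<kappa>) (at (snd \<kappa> p)) (bvec \<mu>)) (at 0)"
proof -
  have "((\<lambda>t. snd \<kappa> p + t *\<^sub>R bvec \<mu>) has_vector_derivative bvec \<mu>) (at 0)"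
    by (auto intro!: derivative_eq_intros)
  \<comment> \<open>The base point is written as the value of the coordinate line at
    \<open>0\<close>, the form in which the chain rule expects it.\<close>
  moreover have "((X \<circ> chart_inv \<kappa>) has_derivative
      frechet_derivative (X \<circ> chart_inv \<kappa>) (at (snd \<kappa> p)))
      (at (snd \<kappa> p + 0 *\<^sub>R bvec \<mu>) within range (\<lambda>t. snd \<kappa> p + t *\<^sub>R bvec \<mu>))"
    using has_derivative_at_withinI[OF frechet_derivative_works[THEN iffD1, OF assms]] by simp
  ultimately have "(((X \<circ> chart_inv \<kappa>) \<circ> (\<lambda>t. snd \<kappa> p + t *\<^sub>R bvec \<mu>)) has_vector_derivative
      frechet_derivative (X \<circ> chart_inv \<kappa>) (at (snd \<kappa> p)) (bvec \<mu>)) (at 0)"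
    by (rule vector_derivative_diff_chain_within)
  then show ?thesis by (simp add: o_def)
qed

lemma pderiv_chart_eq:
  assumes "((\<lambda>t. X (chart_inv \<kappa> (snd \<kappa> p + t *\<^sub>R bvec \<mu>))) has_vector_derivative D) (at 0)"
  shows "pderiv_chart \<kappa> \<mu> X p = D"
  unfolding pderiv_chart_def using assms by (rule vector_derivative_at)

lemma pderiv_chart_const: "pderiv_chart \<kappa> \<mu> (\<lambda>_. v) p = 0"
  by (simp add: pderiv_chart_def)

lemma dir_deriv_bvec: "dir_deriv \<kappa> (\<lambda>_. bvec \<mu>) X p = pderiv_chart \<kappa> \<mu> X p"
proof -
  have "dir_deriv \<kappa> (\<lambda>_. bvec \<mu>) X p =
      (\<Sum>\<nu>\<in>UNIV. if \<nu> = \<mu> then pderiv_chart \<kappa> \<nu> X p else 0)"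
    unfolding dir_deriv_def by (rule sum.cong) (auto simp: inner_axis_axis)
  then show ?thesis by simp
qed

section \<open>Curvature and covariant derivatives along basis fields\<close>

lemma curvature_bvec:
  "curvature \<kappa> \<gamma> (\<lambda>_. bvec \<mu>) (\<lambda>_. bvec \<nu>) c p =
    (pderiv_chart \<kappa> \<mu> (nabla_plus \<kappa> \<gamma> (\<lambda>_. bvec \<nu>) c) p
      + \<gamma> p (bvec \<mu>) (nabla_plus \<kappa> \<gamma> (\<lambda>_. bvec \<nu>) c p))
    - (pderiv_chart \<kappa> \<nu> (nabla_plus \<kappa> \<gamma> (\<lambda>_. bvec \<mu>) c) p
      + \<gamma> p (bvec \<nu>) (nabla_plus \<kappa> \<gamma> (\<lambda>_. bvec \<mu>) c p))"
proof -
  have "lie_bracket \<kappa> (\<lambda>_. bvec \<mu>) (\<lambda>_. bvec \<nu>) p = 0"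
    by (simp add: lie_bracket_def dir_deriv_bvec pderiv_chart_const)
  \<comment> \<open>The operator depends on its direction field only through the value at
    \<open>p\<close>, so vanishing of the bracket at that point suffices.\<close>
  then have "nabla_plus \<kappa> \<gamma> (lie_bracket \<kappa> (\<lambda>_. bvec \<mu>) (\<lambda>_. bvec \<nu>)) c p = 0"
    by (simp add: nabla_plus_def dir_deriv_def)
  moreover have "nabla_plus \<kappa> \<gamma> (\<lambda>_. bvec \<sigma>) X p = pderiv_chart \<kappa> \<sigma> X p + \<gamma> p (bvec \<sigma>) (X p)"
    for \<sigma> X
    by (simp add: nabla_plus_def dir_deriv_bvec)
  ultimately show ?thesis
    unfolding curvature_def by simp
qed

text \<open>In coordinates the field is a directional derivative of \<open>c\<close> plus \<gamma>
  evaluated on a basis vector and on \<open>c\<close>. Smoothness of \<open>c\<close> makes the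
  first summand differentiable again; the second is handled by the product rule for operator
  application.\<close>

lemma nabla_plus_bvec_differentiable:
  assumes "is_chart \<kappa>" "open U" "U \<subseteq> fst \<kappa>" "p \<in> U"
    and c: "smooth_on (c \<circ> chart_inv \<kappa>) (snd \<kappa> ` U)"
    and \<gamma>: "smooth_on (\<gamma> \<circ> chart_inv \<kappa>) (snd \<kappa> ` U)"
  shows "(nabla_plus \<kappa> \<gamma> (\<lambda>_. bvec \<nu>) c \<circ> chart_inv \<kappa>) differentiable (at (snd \<kappa> p))"
proof -
  let ?x = "snd \<kappa> p" and ?V = "snd \<kappa> ` U"
  let ?c = "c \<circ> chart_inv \<kappa>" and ?\<gamma> = "\<gamma> \<circ> chart_inv \<kappa>"
  let ?g = "\<lambda>x. frechet_derivative ?c (at x) (bvec \<nu>) + ?\<gamma> x (bvec \<nu>) (?c x)"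
  have x: "?x \<in> ?V" using assms by blast
  obtain C where C: "(?c has_derivative C) (at ?x)"
    using smooth_on_imp_differentiable[OF c x] unfolding differentiable_def by blast
  obtain G where G: "(?\<gamma> has_derivative G) (at ?x)"
    using smooth_on_imp_differentiable[OF \<gamma> x] unfolding differentiable_def by blast
  obtain E where E: "((\<lambda>x. frechet_derivative ?c (at x) (bvec \<nu>)) has_derivative E) (at ?x)"
    using smooth_on_imp_differentiable[OF smooth_on_frechet_derivative[OF c] x]
    unfolding differentiable_def by blast
  \<comment> \<open>Evaluation at a fixed vector is a bounded linear map on operators, so it
    commutes with differentiation.\<close>
  have "((\<lambda>x. ?\<gamma> x (bvec \<nu>)) has_derivative (\<lambda>h. G h (bvec \<nu>))) (at ?x)"
    by (rule bounded_linear.has_derivative[OF bounded_bilinear.bounded_linear_left[OF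
          bounded_bilinear_blinfun_apply] G])
  from has_derivative_add[OF E bounded_bilinear.FDERIV[OF bounded_bilinear_blinfun_apply this C]]
  obtain D where D: "(?g has_derivative D) (at ?x)" ..
  \<comment> \<open>The two expressions need to agree only on \<open>?V\<close>: this set is open,
    so the derivative at \<open>?x\<close> transfers.\<close>
  have "?g y = (nabla_plus \<kappa> \<gamma> (\<lambda>_. bvec \<nu>) c \<circ> chart_inv \<kappa>) y" if "y \<in> ?V" for y
  proof -
    obtain q where q: "q \<in> U" "y = snd \<kappa> q" using \<open>y \<in> ?V\<close> by blast
    have "pderiv_chart \<kappa> \<nu> c q = frechet_derivative ?c (at y) (bvec \<nu>)"
      unfolding q(2) using q(1)
      by (intro pderiv_chart_eq pderiv_chart_has_vector_derivative smooth_on_imp_differentiable[OF c])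
        blast
    then show ?thesis
      using q assms(3) chart_inv_chart[OF assms(1), of q]
      by (auto simp: nabla_plus_def dir_deriv_bvec)
  qed
  with D have "((nabla_plus \<kappa> \<gamma> (\<lambda>_. bvec \<nu>) c \<circ> chart_inv \<kappa>) has_derivative D) (at ?x)"
    by (rule has_derivative_transform_within_open[OF _ open_chart_image[OF assms(1-3)] x])
  then show ?thesis unfolding differentiable_def by blast
qed

section \<open>The two terms of the right-hand side as double sums over products of basis
  vectors\<close>

lemma ext_deriv_cartan_conn_plus:
  assumes p: "chart_inv \<kappa> (snd \<kappa> p) = p"
    and N: "\<And>\<nu>. (nabla_plus \<kappa> \<gamma> (\<lambda>_. bvec \<nu>) c \<circ> chart_inv \<kappa>) differentiable (at (snd \<kappa> p))"
    and d: "(d \<circ> chart_inv \<kappa>) differentiable (at (snd \<kappa> p))"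
  shows "ext_deriv \<kappa> (\<lambda>q. mv (cartan_conn_plus \<kappa> \<gamma> c d q)) p =
    (\<Sum>\<mu>\<in>UNIV. \<Sum>\<nu>\<in>UNIV.
      (pderiv_chart \<kappa> \<mu> (nabla_plus \<kappa> \<gamma> (\<lambda>_. bvec \<nu>) c) p \<bullet> d p
        + nabla_plus \<kappa> \<gamma> (\<lambda>_. bvec \<nu>) c p \<bullet> pderiv_chart \<kappa> \<mu> d p)
      *\<^sub>R (mv (bvec \<mu>) \<curlywedge> mv (bvec \<nu>)))"
proof -
  let ?N = "\<lambda>\<nu>. nabla_plus \<kappa> \<gamma> (\<lambda>_. bvec \<nu>) c"
  let ?\<phi> = "\<lambda>\<mu> t. chart_inv \<kappa> (snd \<kappa> p + t *\<^sub>R bvec \<mu>)"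
  have mv_plus: "mv (cartan_conn_plus \<kappa> \<gamma> c d q) = (\<Sum>\<nu>\<in>UNIV. (?N \<nu> q \<bullet> d q) *\<^sub>R mv (bvec \<nu>))" for q
    by (simp add: cartan_conn_plus_def linear_sum[OF linear_mv] linear_scale[OF linear_mv])
  have "pderiv_chart \<kappa> \<mu> (\<lambda>q. mv (cartan_conn_plus \<kappa> \<gamma> c d q)) p =
      (\<Sum>\<nu>\<in>UNIV. (pderiv_chart \<kappa> \<mu> (?N \<nu>) p \<bullet> d p + ?N \<nu> p \<bullet> pderiv_chart \<kappa> \<mu> d p)
        *\<^sub>R mv (bvec \<nu>))" for \<mu>
  proof (rule pderiv_chart_eq)
    have diff: "((\<lambda>t. X (?\<phi> \<mu> t)) has_vector_derivative pderiv_chart \<kappa> \<mu> X p) (at 0)"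
      if "(X \<circ> chart_inv \<kappa>) differentiable (at (snd \<kappa> p))" for X :: "_ \<Rightarrow> 'b canonical"
      using pderiv_chart_has_vector_derivative[OF that] pderiv_chart_eq by metis
    have "((\<lambda>t. ?N \<nu> (?\<phi> \<mu> t) \<bullet> d (?\<phi> \<mu> t)) has_vector_derivative
        pderiv_chart \<kappa> \<mu> (?N \<nu>) p \<bullet> d p + ?N \<nu> p \<bullet> pderiv_chart \<kappa> \<mu> d p) (at 0)" for \<nu>
      \<comment> \<open>At \<open>t = 0\<close> the coordinate line passes through \<open>p\<close>;
        this turns the undifferentiated factors into values at \<open>p\<close>.\<close>
      using bounded_bilinear.has_vector_derivative[OF bounded_bilinear_inner diff[OF N] diff[OF d]]
      by (simp add: p add.commute)
    then have "((\<lambda>t. (?N \<nu> (?\<phi> \<mu> t) \<bullet> d (?\<phi> \<mu> t)) *\<^sub>R mv (bvec \<nu>)) has_vector_derivative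
        (pderiv_chart \<kappa> \<mu> (?N \<nu>) p \<bullet> d p + ?N \<nu> p \<bullet> pderiv_chart \<kappa> \<mu> d p) *\<^sub>R mv (bvec \<nu>)) (at 0)"
      for \<nu>
      by (rule bounded_linear.has_vector_derivative[OF bounded_linear_scaleR_left])
    then show "((\<lambda>t. mv (cartan_conn_plus \<kappa> \<gamma> c d (?\<phi> \<mu> t))) has_vector_derivative
        (\<Sum>\<nu>\<in>UNIV. (pderiv_chart \<kappa> \<mu> (?N \<nu>) p \<bullet> d p + ?N \<nu> p \<bullet> pderiv_chart \<kappa> \<mu> d p)
          *\<^sub>R mv (bvec \<nu>))) (at 0)"
      unfolding mv_plus by (intro has_vector_derivative_sum)
  qed
  then show ?thesis
    by (simp add: ext_deriv_def bounded_bilinear.sum_right[OF bounded_bilinear_wedge]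
        bounded_bilinear.scaleR_right[OF bounded_bilinear_wedge])
qed

text \<open>Expanding the wedge bilinearly leaves the sum over \<sigma> in the coefficients, where
  orthonormality collapses it to a single scalar product of the two covariant derivatives. The
  defining property of the adjoint then moves \<gamma> from \<open>d\<close> to the other
  factor.\<close>

lemma sum_cartan_conn_plus_wedge_minus:
  "(\<Sum>\<sigma>\<in>UNIV. mv (cartan_conn_plus \<kappa> \<gamma> c (\<lambda>_. bvec \<sigma>) p) \<curlywedge>
      mv (cartan_conn_minus \<kappa> \<gamma> (\<lambda>_. bvec \<sigma>) d p)) =
    (\<Sum>\<mu>\<in>UNIV. \<Sum>\<nu>\<in>UNIV.
      (nabla_plus \<kappa> \<gamma> (\<lambda>_. bvec \<mu>) c p \<bullet> pderiv_chart \<kappa> \<nu> d p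
        - \<gamma> p (bvec \<nu>) (nabla_plus \<kappa> \<gamma> (\<lambda>_. bvec \<mu>) c p) \<bullet> d p)
      *\<^sub>R (mv (bvec \<mu>) \<curlywedge> mv (bvec \<nu>)))"
proof -
  let ?N = "\<lambda>\<mu>. nabla_plus \<kappa> \<gamma> (\<lambda>_. bvec \<mu>) c p"
  let ?M = "\<lambda>\<nu>. nabla_minus \<kappa> \<gamma> (\<lambda>_. bvec \<nu>) d p"
  have NM: "(\<Sum>\<sigma>\<in>UNIV. (?N \<mu> \<bullet> bvec \<sigma>) * (bvec \<sigma> \<bullet> ?M \<nu>)) =
      ?N \<mu> \<bullet> pderiv_chart \<kappa> \<nu> d p - \<gamma> p (bvec \<nu>) (?N \<mu>) \<bullet> d p" for \<mu> \<nu>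
  proof -
    have "(\<Sum>\<sigma>\<in>UNIV. (?N \<mu> \<bullet> bvec \<sigma>) * (bvec \<sigma> \<bullet> ?M \<nu>)) = ?N \<mu> \<bullet> ?M \<nu>"
      \<comment> \<open>The first simplification turns products with basis vectors into components;
        only then is the remaining scalar product unfolded into the same sum.\<close>
      by (simp add: inner_axis inner_axis') (simp add: inner_vec_def)
    also have "\<dots> = ?N \<mu> \<bullet> pderiv_chart \<kappa> \<nu> d p - \<gamma> p (bvec \<nu>) (?N \<mu>) \<bullet> d p"
      by (simp add: nabla_minus_def dir_deriv_bvec inner_diff_right
          adjoint_works[OF bounded_linear.linear[OF blinfun.bounded_linear_right]])
    finally show ?thesis .
  qed
  have "mv (cartan_conn_plus \<kappa> \<gamma> c (\<lambda>_. bvec \<sigma>) p) \<curlywedge> mv (cartan_conn_minus \<kappa> \<gamma> (\<lambda>_. bvec \<sigma>) d p) =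
      (\<Sum>\<mu>\<in>UNIV. \<Sum>\<nu>\<in>UNIV. ((?N \<mu> \<bullet> bvec \<sigma>) * (bvec \<sigma> \<bullet> ?M \<nu>))
        *\<^sub>R (mv (bvec \<mu>) \<curlywedge> mv (bvec \<nu>)))" for \<sigma>
    \<comment> \<open>The swap matches the order of summation produced by expanding the
      wedge.\<close>
    by (subst sum.swap) (simp add: cartan_conn_plus_def cartan_conn_minus_def linear_sum[OF linear_mv]
        linear_scale[OF linear_mv] bounded_bilinear.sum_left[OF bounded_bilinear_wedge]
        bounded_bilinear.sum_right[OF bounded_bilinear_wedge]
        bounded_bilinear.scaleR_right[OF bounded_bilinear_wedge]
        bounded_bilinear.scaleR_left[OF bounded_bilinear_wedge] scaleR_sum_right
        mult.commute)
  then have "(\<Sum>\<sigma>\<in>UNIV. mv (cartan_conn_plus \<kappa> \<gamma> c (\<lambda>_. bvec \<sigma>) p) \<curlywedge>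
        mv (cartan_conn_minus \<kappa> \<gamma> (\<lambda>_. bvec \<sigma>) d p)) =
      (\<Sum>\<sigma>\<in>UNIV. \<Sum>\<mu>\<in>UNIV. \<Sum>\<nu>\<in>UNIV. ((?N \<mu> \<bullet> bvec \<sigma>) * (bvec \<sigma> \<bullet> ?M \<nu>))
        *\<^sub>R (mv (bvec \<mu>) \<curlywedge> mv (bvec \<nu>)))"
    by simp
  also have "\<dots> = (\<Sum>\<mu>\<in>UNIV. \<Sum>\<sigma>\<in>UNIV. \<Sum>\<nu>\<in>UNIV. ((?N \<mu> \<bullet> bvec \<sigma>) * (bvec \<sigma> \<bullet> ?M \<nu>))
      *\<^sub>R (mv (bvec \<mu>) \<curlywedge> mv (bvec \<nu>)))"
    by (rule sum.swap)
  also have "\<dots> = (\<Sum>\<mu>\<in>UNIV. \<Sum>\<nu>\<in>UNIV. \<Sum>\<sigma>\<in>UNIV. ((?N \<mu> \<bullet> bvec \<sigma>) * (bvec \<sigma> \<bullet> ?M \<nu>))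
      *\<^sub>R (mv (bvec \<mu>) \<curlywedge> mv (bvec \<nu>)))"
    by (intro sum.cong refl sum.swap)
  also have "\<dots> = (\<Sum>\<mu>\<in>UNIV. \<Sum>\<nu>\<in>UNIV.
      (?N \<mu> \<bullet> pderiv_chart \<kappa> \<nu> d p - \<gamma> p (bvec \<nu>) (?N \<mu>) \<bullet> d p)
        *\<^sub>R (mv (bvec \<mu>) \<curlywedge> mv (bvec \<nu>)))"
    unfolding scaleR_sum_left[symmetric] NM ..
  finally show ?thesis .
qed

section \<open>Antisymmetry of the wedge product and the Cartan curvature\<close>

lemma sum_wedge_bvec_swap:
  fixes A :: "'n::{finite, linorder} \<Rightarrow> 'n \<Rightarrow> real"
  shows "(\<Sum>\<mu>\<in>UNIV. \<Sum>\<nu>\<in>UNIV. A \<nu> \<mu> *\<^sub>R (mv (bvec \<mu>) \<curlywedge> mv (bvec \<nu>))) =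
    - (\<Sum>\<mu>\<in>UNIV. \<Sum>\<nu>\<in>UNIV. A \<mu> \<nu> *\<^sub>R (mv (bvec \<mu>) \<curlywedge> mv (bvec \<nu>)))"
proof -
  have "(\<Sum>\<mu>\<in>UNIV. \<Sum>\<nu>\<in>UNIV. A \<nu> \<mu> *\<^sub>R (mv (bvec \<mu>) \<curlywedge> mv (bvec \<nu>))) =
      (\<Sum>\<nu>\<in>UNIV. \<Sum>\<mu>\<in>UNIV. A \<nu> \<mu> *\<^sub>R (mv (bvec \<mu>) \<curlywedge> mv (bvec \<nu>)))"
    by (rule sum.swap)
  also have "\<dots> = (\<Sum>\<nu>\<in>UNIV. \<Sum>\<mu>\<in>UNIV. - (A \<nu> \<mu> *\<^sub>R (mv (bvec \<nu>) \<curlywedge> mv (bvec \<mu>))))"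
    by (intro sum.cong refl) (metis wedge_bvec_anticommute scaleR_minus_right)
  finally show ?thesis by (simp add: sum_negf)
qed

text \<open>By \<open>curvature_bvec\<close> the coefficient has the form
  \<open>A \<mu> \<nu> - A \<nu> \<mu>\<close>. Against an antisymmetric product both halves
  contribute equally, which absorbs the factor 1/2.\<close>

lemma cartan_curvature_eq:
  "cartan_curvature \<kappa> \<gamma> c d p =
    (\<Sum>\<mu>\<in>UNIV. \<Sum>\<nu>\<in>UNIV.
      ((pderiv_chart \<kappa> \<mu> (nabla_plus \<kappa> \<gamma> (\<lambda>_. bvec \<nu>) c) p
        + \<gamma> p (bvec \<mu>) (nabla_plus \<kappa> \<gamma> (\<lambda>_. bvec \<nu>) c p)) \<bullet> d p)
      *\<^sub>R (mv (bvec \<mu>) \<curlywedge> mv (bvec \<nu>)))"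
proof -
  define A where "A \<mu> \<nu> = (pderiv_chart \<kappa> \<mu> (nabla_plus \<kappa> \<gamma> (\<lambda>_. bvec \<nu>) c) p
    + \<gamma> p (bvec \<mu>) (nabla_plus \<kappa> \<gamma> (\<lambda>_. bvec \<nu>) c p)) \<bullet> d p" for \<mu> \<nu>
  have "cartan_curvature \<kappa> \<gamma> c d p =
      (1/2) *\<^sub>R ((\<Sum>\<mu>\<in>UNIV. \<Sum>\<nu>\<in>UNIV. A \<mu> \<nu> *\<^sub>R (mv (bvec \<mu>) \<curlywedge> mv (bvec \<nu>)))
        - (\<Sum>\<mu>\<in>UNIV. \<Sum>\<nu>\<in>UNIV. A \<nu> \<mu> *\<^sub>R (mv (bvec \<mu>) \<curlywedge> mv (bvec \<nu>))))"
    unfolding cartan_curvature_def curvature_bvec inner_diff_left A_def[symmetric]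
    by (simp only: scaleR_diff_left sum_subtractf)
  also have "\<dots> = (\<Sum>\<mu>\<in>UNIV. \<Sum>\<nu>\<in>UNIV. A \<mu> \<nu> *\<^sub>R (mv (bvec \<mu>) \<curlywedge> mv (bvec \<nu>)))"
    unfolding sum_wedge_bvec_swap[of A] by (simp flip: scaleR_2)
  finally show ?thesis unfolding A_def .
qed

theorem mainTheorem3:
  fixes \<A> :: "('m::{t2_space, second_countable_topology}, 'n::{finite, linorder}) chart set"
    and \<kappa> :: "('m, 'n) chart"
    and U :: "'m set"
    and \<gamma> :: "'m \<Rightarrow> 'n bilin"
    and c d :: "'m \<Rightarrow> 'n canonical"
  assumes "smooth_atlas \<A>"
    and "parallelism_structure \<A> \<kappa> U \<gamma>"
    and "smooth_map \<A> U c"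
    and "smooth_map \<A> U d"
  shows "\<forall>p\<in>U. cartan_curvature \<kappa> \<gamma> c d p =
    ext_deriv \<kappa> (\<lambda>q. mv (cartan_conn_plus \<kappa> \<gamma> c d q)) p +
    (\<Sum>\<mu>\<in>UNIV. mv (cartan_conn_plus \<kappa> \<gamma> c (\<lambda>_. bvec \<mu>) p) \<curlywedge>
               mv (cartan_conn_minus \<kappa> \<gamma> (\<lambda>_. bvec \<mu>) d p))"
proof
  fix p assume p: "p \<in> U"
  have U: "\<kappa> \<in> \<A>" "open U" "U \<subseteq> fst \<kappa>"
    using assms(2) by (auto simp: parallelism_structure_def)
  have \<kappa>: "is_chart \<kappa>"
    using assms(1) U(1) by (auto simp: smooth_atlas_def)
  \<comment> \<open>Smoothness on the manifold is used in the single chart \<kappa>, which belongs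
    to the atlas and whose domain contains \<open>U\<close>.\<close>
  have "fst \<kappa> \<inter> U = U" using U(3) by blast
  then have smooth: "smooth_on (c \<circ> chart_inv \<kappa>) (snd \<kappa> ` U)"
      "smooth_on (d \<circ> chart_inv \<kappa>) (snd \<kappa> ` U)" "smooth_on (\<gamma> \<circ> chart_inv \<kappa>) (snd \<kappa> ` U)"
    using assms(2-4) U(1) by (force simp: smooth_map_def parallelism_structure_def)+
  define N where "N \<nu> = nabla_plus \<kappa> \<gamma> (\<lambda>_. bvec \<nu>) c" for \<nu>
  have ext: "ext_deriv \<kappa> (\<lambda>q. mv (cartan_conn_plus \<kappa> \<gamma> c d q)) p =
      (\<Sum>\<mu>\<in>UNIV. \<Sum>\<nu>\<in>UNIV. (pderiv_chart \<kappa> \<mu> (N \<nu>) p \<bullet> d p + N \<nu> p \<bullet> pderiv_chart \<kappa> \<mu> d p)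
        *\<^sub>R (mv (bvec \<mu>) \<curlywedge> mv (bvec \<nu>)))"
    unfolding N_def
  proof (rule ext_deriv_cartan_conn_plus)
    show "chart_inv \<kappa> (snd \<kappa> p) = p"
      using chart_inv_chart[OF \<kappa>] U(3) p by blast
    show "(nabla_plus \<kappa> \<gamma> (\<lambda>_. bvec \<nu>) c \<circ> chart_inv \<kappa>) differentiable (at (snd \<kappa> p))" for \<nu>
      by (rule nabla_plus_bvec_differentiable[OF \<kappa> U(2,3) p smooth(1,3)])
    show "(d \<circ> chart_inv \<kappa>) differentiable (at (snd \<kappa> p))"
      using smooth_on_imp_differentiable[OF smooth(2)] p by blast
  qed
  \<comment> \<open>Interchanging the indices at the cost of a sign puts differentiation on \<mu>
    and \<open>N\<close> on \<nu>, as in \<open>ext\<close>, so that the sums can be compared term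
    by term.\<close>
  have minus: "(\<Sum>\<sigma>\<in>UNIV. mv (cartan_conn_plus \<kappa> \<gamma> c (\<lambda>_. bvec \<sigma>) p) \<curlywedge>
        mv (cartan_conn_minus \<kappa> \<gamma> (\<lambda>_. bvec \<sigma>) d p)) =
      - (\<Sum>\<mu>\<in>UNIV. \<Sum>\<nu>\<in>UNIV. (N \<nu> p \<bullet> pderiv_chart \<kappa> \<mu> d p - \<gamma> p (bvec \<mu>) (N \<nu> p) \<bullet> d p)
        *\<^sub>R (mv (bvec \<mu>) \<curlywedge> mv (bvec \<nu>)))"
    unfolding sum_cartan_conn_plus_wedge_minus N_def
    by (rule sum_wedge_bvec_swap)
  show "cartan_curvature \<kappa> \<gamma> c d p =
      ext_deriv \<kappa> (\<lambda>q. mv (cartan_conn_plus \<kappa> \<gamma> c d q)) p +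
      (\<Sum>\<sigma>\<in>UNIV. mv (cartan_conn_plus \<kappa> \<gamma> c (\<lambda>_. bvec \<sigma>) p) \<curlywedge>
        mv (cartan_conn_minus \<kappa> \<gamma> (\<lambda>_. bvec \<sigma>) d p))"
    \<comment> \<open>Once all sums are split, the terms pairing \<open>N \<nu> p\<close> with the
      derivative of \<open>d\<close> cancel, and the two remaining double sums are those of the
      curvature.\<close>
    unfolding ext minus cartan_curvature_eq N_def[symmetric] inner_add_left
      scaleR_add_left scaleR_diff_left sum.distrib sum_subtractf
    by (rule trans[OF _ diff_conv_add_uminus]) simp
qed

end
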